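(* Let $1\ge\alpha>\beta>\gamma>0$, $\lambda_1,\lambda_2,\lambda_3\in\mathbb{R}$, $y_0\in\mathbb{R}$, and let $g\in C([0,\infty),\mathbb{R})$. The solution $y\in C^{1}([0,\infty),\mathbb{R})$ of the Cauchy problem $$\left({}^{C}D^{\alpha}_{0^+}y\right)(r)-\lambda_{3}\left({}^{C}D^{\beta}_{0^+}y\right)(r)-\lambda_{2}\left({}^{C}D^{\gamma}_{0^+}y\right)(r)-\lambda_{1}y(r)=g(r),\quad r>0,\qquad y(0)=y_0,$$ has the form $$y(r)=\left(1+\lambda_{1}r^{\alpha}E_{\alpha,\alpha-\gamma,\alpha-\beta,\alpha+1}(\lambda_{1}r^{\alpha},\lambda_{2}r^{\alpha-\gamma},\lambda_{3}r^{\alpha-\beta})\right)y_0+\int_{0}^{r}(r-s)^{\alpha-1}E_{\alpha,\alpha-\gamma,\alpha-\beta,\alpha}(\lambda_{1}(r-s)^{\alpha},\lambda_{2}(r-s)^{\alpha-\gamma},\lambda_{3}(r-s)^{\alpha-\beta})\,g(s)\,ds.$$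
   Context: For real $a_1,a_2,a_3>0$ and $\delta\in\mathbb{R}$, the trivariate Mittag-Leffler function (with upper parameter $\eta=1$ omitted from the notation) is $$E_{a_1,a_2,a_3,\delta}(u,v,w)=\sum_{l=0}^{\infty}\sum_{p=0}^{\infty}\sum_{k=0}^{\infty}\frac{(l+p+k)!}{l!\,p!\,k!}\frac{u^l v^p w^k}{\Gamma(la_1+pa_2+ka_3+\delta)},$$ where $1/\Gamma$ is zero at the poles of $\Gamma$. For $0<\rho<1$ the Caputo fractional derivative is $({}^{C}D^{\rho}_{0^+}y)(r)=\frac{1}{\Gamma(1-\rho)}\int_0^r (r-s)^{-\rho}y'(s)\,ds$, $r>0$; for $\rho=1$ it is the ordinary derivative $y'(r)$. *)

theory Defs
  imports "HOL-Analysis.Analysis"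
begin

text \<open>\<open>rGamma\<close> is the entire function \<open>1/\<Gamma>\<close>, which vanishes at the poles of \<open>\<Gamma>\<close>.\<close>

definition ML3 :: "real \<Rightarrow> real \<Rightarrow> real \<Rightarrow> real \<Rightarrow> real \<Rightarrow> real \<Rightarrow> real \<Rightarrow> real" where
  "ML3 a1 a2 a3 \<delta> u v w =
     (\<Sum>l. \<Sum>p. \<Sum>k. fact (l + p + k) / (fact l * fact p * fact k) * (u ^ l * v ^ p * w ^ k)
        * rGamma (real l * a1 + real p * a2 + real k * a3 + \<delta>))"

text \<open>
  \<open>C\<^sup>1([0,\<infinity>))\<close>: the filter \<open>at r within {0..}\<close> makes the derivative one-sided at \<open>0\<close> and
  ordinary at \<open>r > 0\<close>, so values of \<open>y\<close> on the negative axis are irrelevant. The library's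
  \<open>C1_differentiable_on\<close> would require a two-sided derivative at \<open>0\<close>.
\<close>

definition C1_nonneg :: "(real \<Rightarrow> real) \<Rightarrow> bool" where
  "C1_nonneg y \<longleftrightarrow>
     (\<exists>y'. (\<forall>r\<ge>0. (y has_real_derivative y' r) (at r within {0..})) \<and> continuous_on {0..} y')"

text \<open>
  Intended for \<open>0 < \<rho> \<le> 1\<close> and \<open>r > 0\<close>. The two-sided \<open>deriv\<close> may be unspecified at \<open>s = 0\<close>,
  which is a null set for the integral.
\<close>

definition caputo :: "real \<Rightarrow> (real \<Rightarrow> real) \<Rightarrow> real \<Rightarrow> real" where
  "caputo \<rho> y r =
     (if \<rho> = 1 then deriv y r
      else 1 / Gamma (1 - \<rho>) * integral {0..r} (\<lambda>s. (r - s) powr (- \<rho>) * deriv y s))"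

end

theory Submission
  imports Defs
begin

text \<open>
  Write \<open>I\<^sup>a\<close> for the Riemann--Liouville integral and \<open>d = y'\<close>. Since \<open>I\<^sup>\<alpha>\<close> maps the Caputo derivative of
  order \<open>\<rho> \<le> \<alpha>\<close> to \<open>I\<^bsup>\<alpha> - \<rho>\<^esup> I\<^sup>1 d\<close>, applying \<open>I\<^sup>\<alpha>\<close> turns the equation into
  \<open>I\<^sup>1 d = T I\<^sup>1 d + I\<^sup>\<alpha> (l1 y0 + g)\<close> with
  \<open>T = l1 I\<^sup>\<alpha> + l2 I\<^bsup>\<alpha> - \<gamma>\<^esup> + l3 I\<^bsup>\<alpha> - \<beta>\<^esup>\<close>. Iterating gives the Neumann series
  \<open>\<Sum>n. T\<^sup>n I\<^sup>\<alpha> (l1 y0 + g)\<close>; by the semigroup law and the trinomial theorem its kernel is the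
  Mittag-Leffler series grouped by total degree, and the remainder \<open>T\<^sup>n I\<^sup>1 d\<close> vanishes because that
  series converges.
\<close>

section \<open>Trinomial coefficients and sums over triples of fixed total degree\<close>

definition simplex3 :: "nat \<Rightarrow> (nat \<times> nat \<times> nat) set" where
  "simplex3 n = {(l, p, k). l + p + k = n}"

definition trinom :: "nat \<Rightarrow> nat \<Rightarrow> nat \<Rightarrow> real" where
  "trinom l p k = fact (l + p + k) / (fact l * fact p * fact k)"

lemma trinom_nonneg [simp]: "0 \<le> trinom l p k"
  by (simp add: trinom_def)

lemma simplex3_0: "simplex3 0 = {(0, 0, 0)}"
  by (auto simp: simplex3_def)

lemma finite_simplex3 [simp]: "finite (simplex3 n)"
  by (rule finite_subset[of _ "{..n} \<times> {..n} \<times> {..n}"]) (auto simp: simplex3_def)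

text \<open>In each equation both sides are \<open>(l + p + k + 1)!\<close> divided by
  \<open>l! p! k!\<close>.\<close>

lemma trinom_shift:
  "real (Suc (l + p + k)) * trinom l p k = real (Suc l) * trinom (Suc l) p k"
  "real (Suc (l + p + k)) * trinom l p k = real (Suc p) * trinom l (Suc p) k"
  "real (Suc (l + p + k)) * trinom l p k = real (Suc k) * trinom l p (Suc k)"
  by (simp_all add: trinom_def divide_simps del: of_nat_Suc)

text \<open>Pascal recurrence: weight each term by \<open>l + p + k = n + 1\<close> and split the weight into its three summands.\<close>

lemma sum_simplex3_Suc:
  "(\<Sum>(l,p,k)\<in>simplex3 (Suc n). trinom l p k * f l p k) =
   (\<Sum>(l,p,k)\<in>simplex3 n. trinom l p k * (f (Suc l) p k + f l (Suc p) k + f l p (Suc k)))"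
proof -
  \<comment> \<open>Triples with \<open>l = 0\<close> carry weight zero and are dropped; on the
    remaining ones \<open>l - 1\<close> is a genuine inverse of \<open>Suc\<close>. The other two
    coordinates are treated alike.\<close>
  have shift1: "(\<Sum>(l,p,k)\<in>simplex3 (Suc n). real l * (trinom l p k * f l p k)) =
      (\<Sum>(l,p,k)\<in>simplex3 n. real (Suc l) * (trinom (Suc l) p k * f (Suc l) p k))"
    by (rule trans[OF
          sum.mono_neutral_right[where S = "{(l,p,k)\<in>simplex3 (Suc n). l \<noteq> 0}"]
          sum.reindex_bij_witness[where i = "\<lambda>(l,p,k). (Suc l,p,k)" and j = "\<lambda>(l,p,k). (l - 1,p,k)"]],
        rule finite_simplex3) (auto simp: simplex3_def)
  have shift2: "(\<Sum>(l,p,k)\<in>simplex3 (Suc n). real p * (trinom l p k * f l p k)) =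
      (\<Sum>(l,p,k)\<in>simplex3 n. real (Suc p) * (trinom l (Suc p) k * f l (Suc p) k))"
    by (rule trans[OF
          sum.mono_neutral_right[where S = "{(l,p,k)\<in>simplex3 (Suc n). p \<noteq> 0}"]
          sum.reindex_bij_witness[where i = "\<lambda>(l,p,k). (l,Suc p,k)" and j = "\<lambda>(l,p,k). (l,p - 1,k)"]],
        rule finite_simplex3) (auto simp: simplex3_def)
  have shift3: "(\<Sum>(l,p,k)\<in>simplex3 (Suc n). real k * (trinom l p k * f l p k)) =
      (\<Sum>(l,p,k)\<in>simplex3 n. real (Suc k) * (trinom l p (Suc k) * f l p (Suc k)))"
    by (rule trans[OF
          sum.mono_neutral_right[where S = "{(l,p,k)\<in>simplex3 (Suc n). k \<noteq> 0}"]
          sum.reindex_bij_witness[where i = "\<lambda>(l,p,k). (l,p,Suc k)" and j = "\<lambda>(l,p,k). (l,p,k - 1)"]],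
        rule finite_simplex3) (auto simp: simplex3_def)
  have "real (Suc n) * (\<Sum>(l,p,k)\<in>simplex3 (Suc n). trinom l p k * f l p k) =
      (\<Sum>(l,p,k)\<in>simplex3 (Suc n). real l * (trinom l p k * f l p k)) +
      (\<Sum>(l,p,k)\<in>simplex3 (Suc n). real p * (trinom l p k * f l p k)) +
      (\<Sum>(l,p,k)\<in>simplex3 (Suc n). real k * (trinom l p k * f l p k))"
    unfolding sum.distrib[symmetric] sum_distrib_left
  proof (rule sum.cong[OF refl], clarify)
    fix l p k assume "(l,p,k) \<in> simplex3 (Suc n)"
    then have "real (Suc n) = real l + real p + real k"
      by (simp add: simplex3_def flip: of_nat_add)
    then show "real (Suc n) * (trinom l p k * f l p k) = real l * (trinom l p k * f l p k) +
        real p * (trinom l p k * f l p k) + real k * (trinom l p k * f l p k)"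
      by (simp only: distrib_right)
  qed
  also have "\<dots> = (\<Sum>(l,p,k)\<in>simplex3 n. real (Suc n) *
      (trinom l p k * (f (Suc l) p k + f l (Suc p) k + f l p (Suc k))))"
    unfolding shift1 shift2 shift3 sum.distrib[symmetric]
  proof (rule sum.cong[OF refl], clarify)
    fix l p k assume "(l,p,k) \<in> simplex3 n"
    then have n: "n = l + p + k" by (simp add: simplex3_def)
    show "real (Suc l) * (trinom (Suc l) p k * f (Suc l) p k) +
        real (Suc p) * (trinom l (Suc p) k * f l (Suc p) k) +
        real (Suc k) * (trinom l p (Suc k) * f l p (Suc k)) =
      real (Suc n) * (trinom l p k * (f (Suc l) p k + f l (Suc p) k + f l p (Suc k)))"
      unfolding mult.assoc[symmetric] n trinom_shift(1)[of l p k, symmetric]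
        trinom_shift(2)[of l p k, symmetric] trinom_shift(3)[of l p k, symmetric]
      by (simp only: distrib_left)
  qed
  also have "\<dots> = real (Suc n) *
      (\<Sum>(l,p,k)\<in>simplex3 n. trinom l p k * (f (Suc l) p k + f l (Suc p) k + f l p (Suc k)))"
    by (simp add: sum_distrib_left case_prod_unfold)
  finally show ?thesis
    by (simp only: mult_left_cancel[of "real (Suc n)"] of_nat_eq_0_iff nat.distinct simp_thms)
qed

text \<open>Induction by the Pascal recurrence: raising one index multiplies the monomial by
  \<open>u\<close>, \<open>v\<close> or \<open>w\<close>.\<close>

lemma trinomial_theorem:
  "(\<Sum>(l,p,k)\<in>simplex3 n. trinom l p k * (u ^ l * v ^ p * w ^ k)) = (u + v + w) ^ n"
proof (induction n)
  case 0
  show ?case by (simp add: simplex3_0 trinom_def)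
next
  case (Suc n)
  show ?case
    unfolding sum_simplex3_Suc power_Suc Suc.IH[symmetric] sum_distrib_left
    by (rule sum.cong[OF refl]) (auto simp: algebra_simps)
qed

lemma sum_simplex3_UN:
  "(\<Sum>n<N. \<Sum>x\<in>simplex3 n. f x) = sum f (\<Union>n<N. simplex3 n)"
  by (rule sum.UNION_disjoint[symmetric], simp_all) (auto simp: simplex3_def)

text \<open>Truncations by total degree are cofinal among the finite index sets, so they can be used
  to evaluate an unordered sum.\<close>

lemma finite_subset_simplex3_UN:
  assumes "finite F"
  shows "\<exists>N. F \<subseteq> (\<Union>n<N. simplex3 n)"
proof -
  obtain N where "\<forall>m\<in>(\<lambda>(l,p,k). l + p + k) ` F. m < N"
    using assms finite_nat_set_iff_bounded[of "(\<lambda>(l,p,k). l + p + k) ` F"] by blast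
  then show ?thesis by (intro exI[of _ N]) (force simp: simplex3_def)
qed

section \<open>Decay of the reciprocal Gamma function and absolute convergence of the Mittag-Leffler
  series\<close>

text \<open>Restricting Euler's integral to \<open>[B, B + 1]\<close>; here \<open>B\<close> is free, so \<open>1/\<Gamma>\<close> decays faster
  than any exponential.\<close>

lemma rGamma_le_powr:
  fixes B x :: real
  assumes "1 \<le> B" "0 < x"
  shows "rGamma x \<le> (B + 1) * exp (B + 1) * B powr (- x)"
proof -
  define m where "m = B powr x / ((B + 1) * exp (B + 1))"
  have m: "0 < m" using assms by (simp add: m_def)
  have le: "m \<le> t powr (x - 1) / exp t" if "t \<in> {B..B + 1}" for t
  proof -
    \<comment> \<open>The exponent \<open>x - 1\<close> may be negative, so monotonicity is applied
      to \<open>t powr x\<close> and the surplus factor \<open>t\<close> is bounded by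
      \<open>B + 1\<close>.\<close>
    have "B powr x \<le> t powr x" using that assms by (intro powr_mono2) auto
    moreover have "t powr x = t * t powr (x - 1)"
      using that assms by (simp add: powr_mult_base)
    moreover have "t * t powr (x - 1) \<le> (B + 1) * t powr (x - 1)"
      using that by (intro mult_right_mono) auto
    ultimately have "B powr x / (B + 1) \<le> t powr (x - 1)"
      using assms by (simp add: field_simps)
    then have "B powr x / (B + 1) / exp (B + 1) \<le> t powr (x - 1) / exp t"
      using that assms by (intro frac_le) auto
    then show ?thesis by (simp add: m_def)
  qed
  have "((\<lambda>t. if t \<in> {B..B + 1} then m else 0) has_integral m * (B + 1 - B)) {0..}"
    using has_integral_const_real[of m B "B + 1"] assms
    by (subst has_integral_restrict) (auto simp: mult.commute)
  then have "m * (B + 1 - B) \<le> Gamma x"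
    using le by (intro has_integral_le[OF _ Gamma_integral_real[OF assms(2)]]) auto
  then have "m \<le> Gamma x" by simp
  then have "inverse (Gamma x) \<le> inverse m"
    using m by (simp add: le_imp_inverse_le)
  also have "inverse m = (B + 1) * exp (B + 1) * B powr (- x)"
    by (simp add: m_def powr_minus field_simps)
  finally show ?thesis by (simp add: rGamma_inverse_Gamma)
qed

lemma rGamma_nonneg: "0 < x \<Longrightarrow> 0 \<le> rGamma (x :: real)"
  by (simp add: rGamma_inverse_Gamma Gamma_real_pos less_imp_le)

text \<open>Three quantities of size at most \<open>1 / 6\<close> add up to at most
  \<open>1 / 2\<close>, the ratio of the geometric majorant for the series.\<close>

lemma powr_minus_small:
  fixes u a :: real
  assumes "0 < a"
  shows "eventually (\<lambda>B. \<bar>u\<bar> * B powr (- a) \<le> 1 / 6) at_top"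
proof -
  have "((\<lambda>B. \<bar>u\<bar> * B powr (- a)) \<longlongrightarrow> \<bar>u\<bar> * 0) at_top"
    using assms by (intro tendsto_mult tendsto_const tendsto_neg_powr filterlim_ident) auto
  then have "eventually (\<lambda>B. \<bar>u\<bar> * B powr (- a) < 1 / 6) at_top"
    by (rule order_tendstoD) auto
  then show ?thesis by eventually_elim simp
qed

text \<open>Indexing by triples makes the iterated series an unordered sum, which can be regrouped
  freely once it is summable.\<close>

definition ml_term :: "real \<Rightarrow> real \<Rightarrow> real \<Rightarrow> real \<Rightarrow> real \<Rightarrow> real \<Rightarrow> real \<Rightarrow> nat \<times> nat \<times> nat \<Rightarrow> real" where
  "ml_term a1 a2 a3 \<delta> u v w = (\<lambda>(l,p,k). trinom l p k *
     (u ^ l * v ^ p * w ^ k * rGamma (real l * a1 + real p * a2 + real k * a3 + \<delta>)))"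

lemma ML3_altdef: "ML3 a1 a2 a3 \<delta> u v w = (\<Sum>l. \<Sum>p. \<Sum>k. ml_term a1 a2 a3 \<delta> u v w (l, p, k))"
  by (simp add: ML3_def ml_term_def trinom_def mult.assoc)

context
  fixes a1 a2 a3 \<delta> :: real
  assumes pos: "0 < a1" "0 < a2" "0 < a3" "0 < \<delta>"
begin

lemma ml_exponent_pos: "0 < real l * a1 + real p * a2 + real k * a3 + \<delta>"
  using pos by (intro add_nonneg_pos add_nonneg_nonneg) auto

text \<open>All arguments of \<open>rGamma\<close> are positive here, so signs come only from
  \<open>u\<close>, \<open>v\<close> and \<open>w\<close>.\<close>

lemma abs_ml_term: "\<bar>ml_term a1 a2 a3 \<delta> u v w x\<bar> = ml_term a1 a2 a3 \<delta> (\<bar>u\<bar>) (\<bar>v\<bar>) (\<bar>w\<bar>) x"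
  by (auto simp: ml_term_def abs_mult power_abs split_beta rGamma_nonneg[OF ml_exponent_pos])

text \<open>The bound on \<open>rGamma\<close> contributes \<open>B\<close> to minus the exponent,
  which splits into a factor \<open>B powr (- a1)\<close> for each \<open>u\<close>, and likewise
  for \<open>v\<close> and \<open>w\<close>. The trinomial theorem then sums a whole degree to an
  \<open>n\<close>-th power, whose base is at most \<open>1 / 2\<close> for large
  \<open>B\<close>.\<close>

lemma sum_simplex3_abs_ml_term_le:
  "\<exists>C. \<forall>n. (\<Sum>x\<in>simplex3 n. \<bar>ml_term a1 a2 a3 \<delta> u v w x\<bar>) \<le> C * (1 / 2) ^ n"
proof -
  have "eventually (\<lambda>B. 1 \<le> B \<and> \<bar>u\<bar> * B powr (- a1) \<le> 1 / 6 \<and>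
      \<bar>v\<bar> * B powr (- a2) \<le> 1 / 6 \<and> \<bar>w\<bar> * B powr (- a3) \<le> 1 / 6) at_top"
    using pos by (intro eventually_conj eventually_ge_at_top powr_minus_small)
  then obtain B where B: "1 \<le> B" "\<bar>u\<bar> * B powr (- a1) \<le> 1 / 6"
      "\<bar>v\<bar> * B powr (- a2) \<le> 1 / 6" "\<bar>w\<bar> * B powr (- a3) \<le> 1 / 6"
    by (auto simp: eventually_at_top_linorder)
  define C where "C = (B + 1) * exp (B + 1) * B powr (- \<delta>)"
  have C: "0 \<le> C" using B by (simp add: C_def)
  show ?thesis
  proof (intro exI allI)
    fix n
    have "\<bar>ml_term a1 a2 a3 \<delta> u v w (l,p,k)\<bar> \<le> C * (trinom l p k *
       ((\<bar>u\<bar> * B powr (- a1)) ^ l * (\<bar>v\<bar> * B powr (- a2)) ^ p * (\<bar>w\<bar> * B powr (- a3)) ^ k))" for l p k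
    proof -
      let ?e = "real l * a1 + real p * a2 + real k * a3 + \<delta>"
      have "B powr (- ?e) = B powr (- \<delta>) * ((B powr (- a1)) ^ l * (B powr (- a2)) ^ p * (B powr (- a3)) ^ k)"
        using B by (simp add: powr_power powr_add[symmetric] algebra_simps)
      moreover have "rGamma ?e \<le> (B + 1) * exp (B + 1) * B powr (- ?e)"
        by (rule rGamma_le_powr[OF B(1) ml_exponent_pos])
      ultimately have "rGamma ?e \<le> C * ((B powr (- a1)) ^ l * (B powr (- a2)) ^ p * (B powr (- a3)) ^ k)"
        by (simp add: C_def mult_ac)
      then have "trinom l p k * ((\<bar>u\<bar> ^ l * \<bar>v\<bar> ^ p * \<bar>w\<bar> ^ k) * rGamma ?e) \<le>
          trinom l p k * ((\<bar>u\<bar> ^ l * \<bar>v\<bar> ^ p * \<bar>w\<bar> ^ k) *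
            (C * ((B powr (- a1)) ^ l * (B powr (- a2)) ^ p * (B powr (- a3)) ^ k)))"
        by (intro mult_left_mono) auto
      then show ?thesis
        unfolding abs_ml_term by (simp add: ml_term_def power_mult_distrib mult_ac)
    qed
    then have "(\<Sum>x\<in>simplex3 n. \<bar>ml_term a1 a2 a3 \<delta> u v w x\<bar>) \<le> (\<Sum>(l,p,k)\<in>simplex3 n. C * (trinom l p k *
       ((\<bar>u\<bar> * B powr (- a1)) ^ l * (\<bar>v\<bar> * B powr (- a2)) ^ p * (\<bar>w\<bar> * B powr (- a3)) ^ k)))"
      by (intro sum_mono) auto
    also have "\<dots> = C * (\<bar>u\<bar> * B powr (- a1) + \<bar>v\<bar> * B powr (- a2) + \<bar>w\<bar> * B powr (- a3)) ^ n"
      by (simp add: trinomial_theorem[symmetric] sum_distrib_left case_prod_unfold)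
    also have "\<dots> \<le> C * (1 / 2) ^ n"
      using B C by (intro mult_left_mono power_mono) auto
    finally show "(\<Sum>x\<in>simplex3 n. \<bar>ml_term a1 a2 a3 \<delta> u v w x\<bar>) \<le> C * (1 / 2) ^ n" .
  qed
qed

text \<open>A finite index set lies in finitely many degrees, and the degrees are dominated by a
  geometric series.\<close>

lemma ml_term_summable: "ml_term a1 a2 a3 \<delta> u v w summable_on UNIV"
proof -
  obtain C where C: "\<And>n. (\<Sum>x\<in>simplex3 n. \<bar>ml_term a1 a2 a3 \<delta> u v w x\<bar>) \<le> C * (1 / 2) ^ n"
    using sum_simplex3_abs_ml_term_le by blast
  \<comment> \<open>The sign of \<open>C\<close> is not part of the bound; it is read off from
    degree zero.\<close>
  have "0 \<le> (\<Sum>x\<in>simplex3 0. \<bar>ml_term a1 a2 a3 \<delta> u v w x\<bar>)" by (rule sum_nonneg) simp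
  then have "0 \<le> C * (1 / 2) ^ 0" by (rule order_trans[OF _ C])
  then have C0: "0 \<le> C" by simp
  have "(\<lambda>x. \<bar>ml_term a1 a2 a3 \<delta> u v w x\<bar>) summable_on UNIV"
  proof (rule nonneg_bdd_above_summable_on)
    show "bdd_above (sum (\<lambda>x. \<bar>ml_term a1 a2 a3 \<delta> u v w x\<bar>) ` {F. F \<subseteq> UNIV \<and> finite F})"
    proof (rule bdd_aboveI2)
      fix F :: "(nat \<times> nat \<times> nat) set" assume "F \<in> {F. F \<subseteq> UNIV \<and> finite F}"
      then have fin: "finite F" by simp
      obtain N where "F \<subseteq> (\<Union>n<N. simplex3 n)"
        using finite_subset_simplex3_UN[OF fin] by blast
      then have "(\<Sum>x\<in>F. \<bar>ml_term a1 a2 a3 \<delta> u v w x\<bar>) \<le>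
          (\<Sum>n<N. \<Sum>x\<in>simplex3 n. \<bar>ml_term a1 a2 a3 \<delta> u v w x\<bar>)"
        unfolding sum_simplex3_UN by (rule sum_mono2[rotated]) simp_all
      also have "\<dots> \<le> (\<Sum>n<N. C * (1 / 2) ^ n)"
        by (rule sum_mono, rule C)
      also have "\<dots> = C * (\<Sum>n<N. (1 / 2) ^ n)" by (simp add: sum_distrib_left)
      also have "\<dots> \<le> C * 2"
      proof (rule mult_left_mono[OF _ C0])
        have "(\<Sum>n<m. (1 / 2 :: real) ^ n) = 2 - 2 * (1 / 2) ^ m" for m
          by (induction m) simp_all
        then show "(\<Sum>n<N. (1 / 2 :: real) ^ n) \<le> 2" by simp
      qed
      finally show "(\<Sum>x\<in>F. \<bar>ml_term a1 a2 a3 \<delta> u v w x\<bar>) \<le> C * 2" .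
    qed
  qed auto
  then show ?thesis using abs_summable_summable[of "ml_term a1 a2 a3 \<delta> u v w" UNIV] by simp
qed

text \<open>Fubini for summable families, applied twice. The facts \<open>s3\<close>,
  \<open>s4\<close> and \<open>s5\<close> justify replacing each of the three nested
  \<open>suminf\<close> by \<open>infsum\<close>.\<close>

lemma ML3_eq_infsum: "ML3 a1 a2 a3 \<delta> u v w = infsum (ml_term a1 a2 a3 \<delta> u v w) UNIV"
proof -
  let ?f = "ml_term a1 a2 a3 \<delta> u v w"
  have suminf: "suminf h = infsum h UNIV" if "h summable_on UNIV" for h :: "nat \<Rightarrow> real"
    using has_sum_imp_sums[OF has_sum_infsum[OF that]] by (simp add: sums_iff)
  have s1: "?f summable_on (UNIV \<times> UNIV)" using ml_term_summable by simp
  have s2: "(\<lambda>y. ?f (l, y)) summable_on (UNIV \<times> UNIV)" for l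
    using summable_on_SigmaD1[of "\<lambda>l y. ?f (l, y)" UNIV "\<lambda>_. UNIV" l] s1 by simp
  have s3: "(\<lambda>k. ?f (l, p, k)) summable_on UNIV" for l p
    using summable_on_SigmaD1[of "\<lambda>p k. ?f (l, p, k)" UNIV "\<lambda>_. UNIV" p] s2[of l]
    by (simp add: case_prod_unfold)
  have s4: "(\<lambda>p. infsum (\<lambda>k. ?f (l, p, k)) UNIV) summable_on UNIV" for l
    using summable_on_Sigma_banach[of "\<lambda>p k. ?f (l, p, k)" UNIV "\<lambda>_. UNIV"] s2[of l]
    by (simp add: case_prod_unfold)
  have e2: "infsum (\<lambda>p. infsum (\<lambda>k. ?f (l, p, k)) UNIV) UNIV = infsum (\<lambda>y. ?f (l, y)) UNIV" for l
    using infsum_Sigma_banach[of "\<lambda>y. ?f (l, y)" UNIV "\<lambda>_. UNIV"] s2[of l] by simp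
  have s5: "(\<lambda>l. infsum (\<lambda>y. ?f (l, y)) UNIV) summable_on UNIV"
    using summable_on_Sigma_banach[of "\<lambda>l y. ?f (l, y)" UNIV "\<lambda>_. UNIV"] s1
    by (simp add: case_prod_unfold)
  have e1: "infsum (\<lambda>l. infsum (\<lambda>y. ?f (l, y)) UNIV) UNIV = infsum ?f UNIV"
    using infsum_Sigma_banach[of ?f UNIV "\<lambda>_. UNIV"] s1 by simp
  show ?thesis
    unfolding ML3_altdef by (simp add: suminf s3 s4 s5 e1 e2)
qed

text \<open>Regrouping by total degree is the form in which the series meets the powers
  \<open>T^n\<close>.\<close>

lemma ML3_partial_sums:
  "(\<lambda>N. \<Sum>n<N. \<Sum>x\<in>simplex3 n. ml_term a1 a2 a3 \<delta> u v w x) \<longlonglongrightarrow> ML3 a1 a2 a3 \<delta> u v w"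
proof -
  have "(sum (ml_term a1 a2 a3 \<delta> u v w) \<longlongrightarrow> ML3 a1 a2 a3 \<delta> u v w) (finite_subsets_at_top UNIV)"
    using has_sum_infsum[OF ml_term_summable] by (simp add: has_sum_def ML3_eq_infsum)
  moreover have "filterlim (\<lambda>N. \<Union>n<N. simplex3 n) (finite_subsets_at_top UNIV) sequentially"
    unfolding filterlim_finite_subsets_at_top
  proof safe
    fix F :: "(nat \<times> nat \<times> nat) set" assume fin: "finite F"
    obtain N where *: "F \<subseteq> (\<Union>n<N. simplex3 n)"
      using finite_subset_simplex3_UN[OF fin] by blast
    show "\<forall>\<^sub>F N in sequentially. finite (\<Union>n<N. simplex3 n) \<and> F \<subseteq> (\<Union>n<N. simplex3 n) \<and>
        (\<Union>n<N. simplex3 n) \<subseteq> UNIV"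
      using eventually_ge_at_top[of N]
    proof eventually_elim
      case (elim M)
      then have "(\<Union>n<N. simplex3 n) \<subseteq> (\<Union>n<M. simplex3 n)" by (intro UN_mono) auto
      with * show ?case by auto
    qed
  qed
  ultimately show ?thesis
    unfolding sum_simplex3_UN by (rule filterlim_compose)
qed

end

section \<open>The Riemann-Liouville kernel, its integral operator and the semigroup law\<close>

definition frac_ker :: "real \<Rightarrow> real \<Rightarrow> real" where
  "frac_ker a t = (if 0 < t then t powr (a - 1) * rGamma a else 0)"

definition frac_int :: "real \<Rightarrow> (real \<Rightarrow> real) \<Rightarrow> real \<Rightarrow> real" where
  "frac_int a f r = (LINT s|lborel. frac_ker a (r - s) * f s)"

text \<open>On functions that vanish on \<open>(-\<infinity>, 0]\<close>, this convolution over the whole line is the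
  Riemann--Liouville integral \<open>I\<^sup>a\<close> based at \<open>0\<close>.\<close>

definition causal_bdd :: "(real \<Rightarrow> real) \<Rightarrow> bool" where
  "causal_bdd f \<longleftrightarrow> f \<in> borel_measurable borel \<and> (\<forall>x\<le>0. f x = 0) \<and> (\<forall>R. \<exists>M. \<forall>x\<le>R. \<bar>f x\<bar> \<le> M)"

lemma frac_ker_measurable [measurable]: "frac_ker a \<in> borel_measurable borel"
  unfolding frac_ker_def by measurable

lemma frac_ker_nonneg: "0 < a \<Longrightarrow> 0 \<le> frac_ker a t"
  by (simp add: frac_ker_def rGamma_nonneg)

lemma frac_ker_1: "frac_ker 1 t = (if 0 < t then 1 else 0)"
  by (simp add: frac_ker_def)

text \<open>The Beta integral, rescaled from \<open>[0, 1]\<close> to \<open>[u, r]\<close>.\<close>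

lemma frac_ker_convolution:
  assumes a: "0 < a" and b: "0 < b"
  shows "has_bochner_integral lborel (\<lambda>s. frac_ker a (r - s) * frac_ker b (s - u)) (frac_ker (a + b) (r - u))"
proof (cases "u < r")
  case False
  then have "(\<lambda>s. frac_ker a (r - s) * frac_ker b (s - u)) = (\<lambda>_. 0)"
    by (auto simp: frac_ker_def)
  then show ?thesis using False by (simp add: frac_ker_def has_bochner_integral_zero)
next
  case True
  define h where "h = r - u"
  have h: "0 < h" using True by (simp add: h_def)
  define B where "B = (\<lambda>t::real. indicator {0..1} t * (t powr (b - 1) * (1 - t) powr (a - 1)))"
  have "has_bochner_integral lborel B (Beta b a)"
  proof (rule has_bochner_integral_nn_integral)
    show "(\<integral>\<^sup>+t. ennreal (B t) \<partial>lborel) = ennreal (Beta b a)"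
      unfolding B_def
      by (subst nn_integral_has_integral_lebesgue[OF _ has_integral_Beta_real[OF b a]]) auto
    show "0 \<le> Beta b a" using a b by (simp add: Beta_def Gamma_real_pos less_imp_le)
  qed (auto simp: B_def)
  then have "has_bochner_integral lborel (\<lambda>s. B (- u / h + (1 / h) * s)) (h * Beta b a)"
    using h by (subst (asm) lborel_has_bochner_integral_real_affine_iff[of "1/h" _ _ "- u / h"]) auto
  \<comment> \<open>The two kernels scale by \<open>h powr (a - 1)\<close> and
    \<open>h powr (b - 1)\<close>, and the substitution adds one factor \<open>h\<close>; together
    these give \<open>h powr (a + b - 1)\<close>.\<close>
  then have "has_bochner_integral lborel
      (\<lambda>s. (h powr (a - 1) * h powr (b - 1) * rGamma a * rGamma b) * B (- u / h + (1 / h) * s))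
      ((h powr (a - 1) * h powr (b - 1) * rGamma a * rGamma b) * (h * Beta b a))"
    by (rule has_bochner_integral_mult_right)
  moreover have "(\<lambda>s. (h powr (a - 1) * h powr (b - 1) * rGamma a * rGamma b) * B (- u / h + (1 / h) * s))
      = (\<lambda>s. frac_ker a (r - s) * frac_ker b (s - u))"
  proof
    fix s
    have arg: "- u / h + (1 / h) * s = (s - u) / h" by (simp add: diff_divide_distrib)
    have arg': "1 - (s - u) / h = (r - s) / h" using h by (simp add: h_def field_simps)
    \<comment> \<open>At the endpoints \<open>B\<close> is zero because \<open>0 powr x = 0\<close>,
      so the two functions agree at every point.\<close>
    consider "s \<le> u" | "r \<le> s" | "u < s" "s < r" by linarith
    then show "(h powr (a - 1) * h powr (b - 1) * rGamma a * rGamma b) * B (- u / h + (1 / h) * s) =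
        frac_ker a (r - s) * frac_ker b (s - u)"
    proof cases
      case 1
      then have "s - u = 0 \<or> (s - u) / h < 0" using h by (auto simp: field_simps)
      then show ?thesis using 1 unfolding arg by (auto simp: B_def frac_ker_def)
    next
      case 2
      then have "(s - u) / h = 1 \<or> 1 < (s - u) / h" using h by (auto simp: field_simps h_def)
      then show ?thesis using 2 unfolding arg by (auto simp: B_def frac_ker_def)
    next
      case 3
      then have "(s - u) / h \<in> {0..1}" using h by (auto simp: field_simps h_def)
      then show ?thesis using 3 h unfolding arg
        by (simp add: B_def arg' frac_ker_def powr_divide)
    qed
  qed
  moreover have "(h powr (a - 1) * h powr (b - 1) * rGamma a * rGamma b) * (h * Beta b a) =
      frac_ker (a + b) (r - u)"
  proof -
    have "Gamma a \<noteq> 0" "Gamma b \<noteq> 0"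
      using a b by (simp_all add: Gamma_real_pos less_imp_neq[symmetric])
    then have "(rGamma a * Gamma a) * (rGamma b * Gamma b) * rGamma (a + b) = rGamma (a + b)"
      unfolding rGamma_inverse_Gamma[of a] rGamma_inverse_Gamma[of b] by simp
    then have "rGamma a * rGamma b * Beta b a = rGamma (a + b)"
      by (simp only: Beta_altdef add.commute[of b a] mult_ac)
    moreover have "h powr (a - 1) * h powr (b - 1) * h = h powr (a + b - 1)"
      using h powr_mult_base[of h "a + b - 2"] by (simp add: mult.commute flip: powr_add)
    moreover have "h powr (a - 1) * h powr (b - 1) * rGamma a * rGamma b * (h * Beta b a) =
       (h powr (a - 1) * h powr (b - 1) * h) * (rGamma a * rGamma b * Beta b a)"
      by (simp only: mult_ac)
    ultimately have "h powr (a - 1) * h powr (b - 1) * rGamma a * rGamma b * (h * Beta b a) =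
        h powr (a + b - 1) * rGamma (a + b)"
      by (simp only:)
    then show ?thesis
      using h unfolding frac_ker_def h_def[symmetric] by (simp only: if_True)
  qed
  ultimately show ?thesis by simp
qed

text \<open>Since \<open>frac_ker 1\<close> is the unit step, this is the integral of the kernel
  from \<open>0\<close> to \<open>r\<close>; it serves as the majorant in the estimates for
  \<open>frac_int\<close>.\<close>

lemma frac_ker_integral:
  assumes "0 < a"
  shows "has_bochner_integral lborel (\<lambda>s. frac_ker a (r - s) * frac_ker 1 s) (frac_ker (a + 1) r)"
  using frac_ker_convolution[OF assms zero_less_one, of r 0] by simp

lemma causal_bddD:
  assumes "causal_bdd f"
  shows "f \<in> borel_measurable borel" "x \<le> 0 \<Longrightarrow> f x = 0" "\<exists>M\<ge>0. \<forall>x\<le>R. \<bar>f x\<bar> \<le> M"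
proof -
  obtain M where "\<forall>x\<le>R. \<bar>f x\<bar> \<le> M" using assms unfolding causal_bdd_def by blast
  then have "\<forall>x\<le>R. \<bar>f x\<bar> \<le> \<bar>M\<bar>" by force
  then show "\<exists>M\<ge>0. \<forall>x\<le>R. \<bar>f x\<bar> \<le> M" by (intro exI[of _ "\<bar>M\<bar>"]) simp
qed (use assms in \<open>auto simp: causal_bdd_def\<close>)

text \<open>Outside the interval from \<open>0\<close> to \<open>r\<close> both sides vanish, by
  causality of \<open>f\<close> on the left end and by the cut-off of the kernel on the right
  end.\<close>

lemma frac_ker_mult_le:
  assumes "0 < a" "causal_bdd f" "\<And>x. x \<le> r \<Longrightarrow> \<bar>f x\<bar> \<le> M"
  shows "\<bar>frac_ker a (r - s) * f s\<bar> \<le> M * (frac_ker a (r - s) * frac_ker 1 s)"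
proof (cases "0 < s \<and> s < r")
  case True
  then show ?thesis
    using assms(3)[of s] frac_ker_nonneg[OF assms(1), of "r - s"]
    by (auto simp: abs_mult frac_ker_1 mult.commute[of M] intro!: mult_left_mono)
next
  case False
  then show ?thesis
    using causal_bddD(2)[OF assms(2), of s] by (auto simp: frac_ker_def)
qed

lemma frac_int_integrable:
  assumes a: "0 < a" and f: "causal_bdd f"
  shows "integrable lborel (\<lambda>s. frac_ker a (r - s) * f s)"
proof -
  note [measurable] = causal_bddD(1)[OF f]
  obtain M where M: "M \<ge> 0" "\<And>x. x \<le> r \<Longrightarrow> \<bar>f x\<bar> \<le> M" using causal_bddD(3)[OF f] by blast
  have "integrable lborel (\<lambda>s. M * (frac_ker a (r - s) * frac_ker 1 s))"
    using frac_ker_integral[OF a, of r] by (simp add: has_bochner_integral_iff)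
  then show ?thesis
    by (rule Bochner_Integration.integrable_bound)
       (auto intro!: order_trans[OF frac_ker_mult_le[OF a f M(2)]])
qed

lemma frac_int_bound:
  assumes a: "0 < a" and f: "causal_bdd f" and M: "\<And>x. x \<le> r \<Longrightarrow> \<bar>f x\<bar> \<le> M"
  shows "\<bar>frac_int a f r\<bar> \<le> M * frac_ker (a + 1) r"
proof -
  have *: "has_bochner_integral lborel (\<lambda>s. M * (frac_ker a (r - s) * frac_ker 1 s)) (M * frac_ker (a + 1) r)"
    by (intro has_bochner_integral_mult_right frac_ker_integral a)
  have "\<bar>frac_int a f r\<bar> \<le> (LINT s|lborel. M * (frac_ker a (r - s) * frac_ker 1 s))"
    unfolding frac_int_def real_norm_def[symmetric]
  proof (rule order_trans[OF integral_norm_bound integral_mono])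
    show "integrable lborel (\<lambda>s. norm (frac_ker a (r - s) * f s))"
      using frac_int_integrable[OF a f] by (rule integrable_norm)
    show "integrable lborel (\<lambda>s. M * (frac_ker a (r - s) * frac_ker 1 s))"
      using * by (simp only: has_bochner_integral_iff)
    show "norm (frac_ker a (r - s) * f s) \<le> M * (frac_ker a (r - s) * frac_ker 1 s)" for s
      using frac_ker_mult_le[OF a f M] by (simp only: real_norm_def)
  qed
  also have "\<dots> = M * frac_ker (a + 1) r" using * by (simp add: has_bochner_integral_iff)
  finally show ?thesis .
qed

lemma frac_int_nonpos: "causal_bdd f \<Longrightarrow> r \<le> 0 \<Longrightarrow> frac_int a f r = 0"
proof -
  assume "causal_bdd f" "r \<le> 0"
  then have "(\<lambda>s. frac_ker a (r - s) * f s) = (\<lambda>_. 0)"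
    by (auto simp: fun_eq_iff frac_ker_def causal_bddD(2))
  then show ?thesis by (simp add: frac_int_def)
qed

lemma causal_bdd_frac_int:
  assumes a: "0 < a" and f: "causal_bdd f"
  shows "causal_bdd (frac_int a f)"
  unfolding causal_bdd_def
proof (intro conjI allI impI)
  note [measurable] = causal_bddD(1)[OF f]
  show "frac_int a f \<in> borel_measurable borel"
    unfolding frac_int_def by measurable
  show "frac_int a f x = 0" if "x \<le> 0" for x
    using frac_int_nonpos[OF f that] .
  fix R
  obtain M where M: "M \<ge> 0" "\<And>x. x \<le> R \<Longrightarrow> \<bar>f x\<bar> \<le> M" using causal_bddD(3)[OF f] by blast
  have "\<bar>frac_int a f x\<bar> \<le> M * (\<bar>R\<bar> powr a * rGamma (a + 1))" if x: "x \<le> R" for x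
  proof -
    have "\<bar>frac_int a f x\<bar> \<le> M * frac_ker (a + 1) x"
      using M(2) x by (intro frac_int_bound[OF a f]) auto
    also have "\<dots> \<le> M * (\<bar>R\<bar> powr a * rGamma (a + 1))"
      using M(1) a x by (auto simp: frac_ker_def rGamma_nonneg intro!: mult_left_mono mult_right_mono powr_mono2)
    finally show ?thesis .
  qed
  then show "\<exists>M. \<forall>x\<le>R. \<bar>frac_int a f x\<bar> \<le> M" by blast
qed

lemma causal_bdd_add: "causal_bdd f \<Longrightarrow> causal_bdd g \<Longrightarrow> causal_bdd (\<lambda>x. f x + g x)"
  unfolding causal_bdd_def
proof (intro conjI allI impI; (elim conjE)?)
  fix R assume "\<forall>R. \<exists>M. \<forall>x\<le>R. \<bar>f x\<bar> \<le> M" "\<forall>R. \<exists>M. \<forall>x\<le>R. \<bar>g x\<bar> \<le> M"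
  then obtain M N where "\<forall>x\<le>R. \<bar>f x\<bar> \<le> M" "\<forall>x\<le>R. \<bar>g x\<bar> \<le> N" by meson
  then have "\<forall>x\<le>R. \<bar>f x + g x\<bar> \<le> M + N" by (smt (verit))
  then show "\<exists>M. \<forall>x\<le>R. \<bar>f x + g x\<bar> \<le> M" by blast
qed auto

lemma causal_bdd_cmult: "causal_bdd f \<Longrightarrow> causal_bdd (\<lambda>x. c * f x)"
  unfolding causal_bdd_def
proof (intro conjI allI impI; (elim conjE)?)
  fix R assume "\<forall>R. \<exists>M. \<forall>x\<le>R. \<bar>f x\<bar> \<le> M"
  then obtain M where "\<forall>x\<le>R. \<bar>f x\<bar> \<le> M" by meson
  then have "\<forall>x\<le>R. \<bar>c * f x\<bar> \<le> \<bar>c\<bar> * M" by (simp add: abs_mult mult_left_mono)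
  then show "\<exists>M. \<forall>x\<le>R. \<bar>c * f x\<bar> \<le> M" by blast
qed auto

lemma frac_int_add:
  "0 < a \<Longrightarrow> causal_bdd f \<Longrightarrow> causal_bdd g \<Longrightarrow>
    frac_int a (\<lambda>x. f x + g x) r = frac_int a f r + frac_int a g r"
  by (simp add: frac_int_def distrib_left frac_int_integrable)

lemma frac_int_cmult: "frac_int a (\<lambda>x. c * f x) r = c * frac_int a f r"
  by (simp add: frac_int_def mult.left_commute[of _ c])

text \<open>Fubini reduces the semigroup law to the convolution identity of the kernels. The kernels
  are nonnegative, so the same identity with \<open>\<bar>f u\<bar>\<close> in place of
  \<open>f u\<close> gives the integrability that Fubini requires.\<close>

lemma frac_int_frac_int:
  assumes a: "0 < a" and b: "0 < b" and f: "causal_bdd f"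
  shows "frac_int a (frac_int b f) r = frac_int (a + b) f r"
proof -
  note [measurable] = causal_bddD(1)[OF f]
  obtain M where M: "M \<ge> 0" "\<And>x. x \<le> r \<Longrightarrow> \<bar>f x\<bar> \<le> M" using causal_bddD(3)[OF f] by blast
  define H where "H = (\<lambda>s u. frac_ker a (r - s) * (frac_ker b (s - u) * f u))"
  have [measurable]: "case_prod H \<in> borel_measurable (lborel \<Otimes>\<^sub>M lborel)"
    unfolding H_def by measurable
  have int_s: "integrable lborel (\<lambda>s. H s u)" 
    and lint_s: "(LINT s|lborel. H s u) = frac_ker (a + b) (r - u) * f u" for u
    using frac_ker_convolution[OF a b, of r u]
    by (simp_all add: has_bochner_integral_iff H_def mult.assoc[symmetric])
  have normH: "norm (H s u) = frac_ker a (r - s) * frac_ker b (s - u) * \<bar>f u\<bar>" for s u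
    by (simp add: H_def abs_mult frac_ker_nonneg a b)
  have f': "causal_bdd (\<lambda>x. \<bar>f x\<bar>)" using f by (auto simp: causal_bdd_def)
  have H_int: "integrable (lborel \<Otimes>\<^sub>M lborel) (\<lambda>(u, s). H s u)"
  proof (rule lborel_pair.Fubini_integrable)
    show "(\<lambda>(u, s). H s u) \<in> borel_measurable (lborel \<Otimes>\<^sub>M lborel)"
      unfolding H_def by measurable
    have "(LINT s|lborel. norm (H s u)) = frac_ker (a + b) (r - u) * \<bar>f u\<bar>" for u
      using frac_ker_convolution[OF a b, of r u]
      unfolding normH by (simp add: has_bochner_integral_iff)
    then show "integrable lborel (\<lambda>u. LINT s|lborel. norm (case (u, s) of (u, s) \<Rightarrow> H s u))"
      using frac_int_integrable[OF _ f', of "a + b" r] a b by simp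
    show "AE u in lborel. integrable lborel (\<lambda>s. case (u, s) of (u, s) \<Rightarrow> H s u)"
      using int_s by simp
  qed
  have "frac_int a (frac_int b f) r = (LINT s|lborel. LINT u|lborel. H s u)"
    unfolding frac_int_def H_def by simp
  also have "\<dots> = (LINT u|lborel. LINT s|lborel. H s u)"
    using lborel_pair.Fubini_integral[of "\<lambda>u s. H s u"] H_int by simp
  also have "\<dots> = frac_int (a + b) f r"
    by (simp add: lint_s frac_int_def)
  finally show ?thesis .
qed

lemma causal_bdd_frac_ker_1: "causal_bdd (frac_ker 1)"
  unfolding causal_bdd_def by (auto simp: frac_ker_1)

lemma frac_int_frac_ker_1: "0 < a \<Longrightarrow> frac_int a (frac_ker 1) r = frac_ker (a + 1) r"
  using frac_ker_integral[of a r] by (simp add: frac_int_def has_bochner_integral_iff)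

section \<open>Continuous data, and the passage from the real line to bounded intervals\<close>

lemma causal_bdd_continuous:
  fixes h :: "real \<Rightarrow> real"
  assumes "continuous_on {0..} h"
  shows "causal_bdd (\<lambda>x. if 0 < x then h x else 0)"
  unfolding causal_bdd_def
proof (intro conjI allI impI)
  have "(\<lambda>x. indicator {0<..} x *\<^sub>R h x) \<in> borel_measurable borel"
    by (intro borel_measurable_continuous_on_indicator continuous_on_subset[OF assms]) auto
  also have "(\<lambda>x. indicator {0<..} x *\<^sub>R h x) = (\<lambda>x. if 0 < x then h x else 0)"
    by (auto simp: fun_eq_iff)
  finally show "(\<lambda>x. if 0 < x then h x else 0) \<in> borel_measurable borel" .
  fix R
  have "compact (h ` {0..R})"
    by (intro compact_continuous_image continuous_on_subset[OF assms]) auto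
  then obtain M where "\<forall>x\<in>{0..R}. \<bar>h x\<bar> \<le> M"
    by (auto simp: dest!: compact_imp_bounded simp: bounded_iff)
  \<comment> \<open>For negative \<open>R\<close> the interval is empty and \<open>M\<close> may be
    negative; the absolute value covers this case and the points \<open>x \<le> 0\<close>.\<close>
  then have "\<forall>x\<le>R. \<bar>if 0 < x then h x else 0\<bar> \<le> \<bar>M\<bar>"
    by (auto intro: order_trans[OF _ abs_ge_self])
  then show "\<exists>M. \<forall>x\<le>R. \<bar>if 0 < x then h x else 0\<bar> \<le> M" by blast
qed auto

text \<open>Agreement on the open interval suffices, since the two endpoints form a finite
  exceptional set. Values of \<open>deriv y\<close> at \<open>0\<close> or of a singular power at
  \<open>r\<close> therefore do not matter.\<close>

lemma has_integral_of_lborel: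
  fixes f h :: "real \<Rightarrow> real"
  assumes f: "integrable lborel f" and out: "\<And>s. s \<notin> {0<..<r} \<Longrightarrow> f s = 0"
    and h: "\<And>s. s \<in> {0<..<r} \<Longrightarrow> h s = f s"
  shows "(h has_integral integral\<^sup>L lborel f) {0..r}"
proof -
  have "(f has_integral integral\<^sup>L lborel f) UNIV" by (rule has_integral_integral_lborel[OF f])
  moreover have "f = (\<lambda>s. if s \<in> {0..r} then f s else 0)"
  proof
    fix s show "f s = (if s \<in> {0..r} then f s else 0)" using out[of s] by auto
  qed
  ultimately have "((\<lambda>s. if s \<in> {0..r} then f s else 0) has_integral integral\<^sup>L lborel f) UNIV" by simp
  then have "(f has_integral integral\<^sup>L lborel f) {0..r}"
    by (simp only: has_integral_restrict_UNIV)
  then show ?thesis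
    by (rule has_integral_spike_finite[of "{0, r}", rotated 2]) (use h in auto)
qed

text \<open>The factor \<open>Gamma a\<close> undoes the normalisation of the kernel. The lemma
  serves the Caputo integral with \<open>a = 1 - \<rho>\<close> and the ordinary integral of
  \<open>y'\<close> with \<open>a = 1\<close>.\<close>

lemma has_integral_frac_int:
  assumes a: "0 < a" and f: "causal_bdd f"
    and h: "\<And>s. 0 < s \<Longrightarrow> s < r \<Longrightarrow> h s = (r - s) powr (a - 1) * f s"
  shows "(h has_integral Gamma a * frac_int a f r) {0..r}"
proof -
  have G: "Gamma a \<noteq> 0" using a by (simp add: Gamma_real_pos less_imp_neq[symmetric])
  have "(h has_integral integral\<^sup>L lborel (\<lambda>s. Gamma a * (frac_ker a (r - s) * f s))) {0..r}"
  proof (rule has_integral_of_lborel)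
    show "integrable lborel (\<lambda>s. Gamma a * (frac_ker a (r - s) * f s))"
      using frac_int_integrable[OF a f, of r] by simp
    show "Gamma a * (frac_ker a (r - s) * f s) = 0" if "s \<notin> {0<..<r}" for s
      using that causal_bddD(2)[OF f, of s] by (cases "s \<le> 0") (auto simp: frac_ker_def)
    show "h s = Gamma a * (frac_ker a (r - s) * f s)" if "s \<in> {0<..<r}" for s
      using that h[of s] G by (simp add: frac_ker_def rGamma_inverse_Gamma)
  qed
  then show ?thesis by (simp add: frac_int_def)
qed

section \<open>Iteration of the integral equation\<close>

locale ml_resolvent =
  fixes a1 a2 a3 l1 l2 l3 :: real
  assumes a1: "0 < a1" and a2: "0 < a2" and a3: "0 < a3"
begin

definition expo :: "nat \<Rightarrow> nat \<Rightarrow> nat \<Rightarrow> real" where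
  "expo l p k = real l * a1 + real p * a2 + real k * a3"

lemma expo_nonneg: "0 \<le> expo l p k"
  unfolding expo_def using a1 a2 a3 by (intro add_nonneg_nonneg) auto

text \<open>With \<open>T = l1 I\<^bsup>a1\<^esup> + l2 I\<^bsup>a2\<^esup> + l3 I\<^bsup>a3\<^esup>\<close> this is \<open>T\<^sup>n I\<^sup>\<delta> f\<close>, expanded by the trinomial
  theorem and the semigroup law.\<close>

definition resolvent_term :: "nat \<Rightarrow> real \<Rightarrow> (real \<Rightarrow> real) \<Rightarrow> real \<Rightarrow> real" where
  "resolvent_term n \<delta> f r =
     (\<Sum>(l,p,k)\<in>simplex3 n. trinom l p k * (l1 ^ l * l2 ^ p * l3 ^ k * frac_int (expo l p k + \<delta>) f r))"

text \<open>The convolution kernel of the sum over \<open>n\<close> of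
  \<open>T^n I^\<delta>\<close>, as \<open>resolvent_sum_tendsto\<close> shows.\<close>

definition ml_ker :: "real \<Rightarrow> real \<Rightarrow> real" where
  "ml_ker \<delta> t = (if 0 < t then t powr (\<delta> - 1) *
     ML3 a1 a2 a3 \<delta> (l1 * t powr a1) (l2 * t powr a2) (l3 * t powr a3) else 0)"

text \<open>The powers of \<open>t\<close> coming from \<open>expo l p k\<close> are absorbed into
  the three arguments of the series; only \<open>t powr (\<delta> - 1)\<close> stays
  outside.\<close>

lemma frac_ker_expo:
  assumes "0 < t"
  shows "trinom l p k * (c1 ^ l * c2 ^ p * c3 ^ k * frac_ker (expo l p k + \<delta>) t) =
    t powr (\<delta> - 1) * ml_term a1 a2 a3 \<delta> (c1 * t powr a1) (c2 * t powr a2) (c3 * t powr a3) (l, p, k)"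
proof -
  have "t powr (expo l p k + \<delta> - 1) = t powr (\<delta> - 1) * ((t powr a1) ^ l * (t powr a2) ^ p * (t powr a3) ^ k)"
    using assms by (simp add: expo_def powr_power powr_add[symmetric] algebra_simps)
  then show ?thesis
    using assms by (simp add: frac_ker_def ml_term_def expo_def power_mult_distrib mult_ac)
qed

text \<open>The hypothesis \<open>eq\<close> says \<open>I^1 d = T I^1 d + I^\<alpha> F\<close>, and
  \<open>T^n\<close> is applied to it term by term. The Pascal recurrence collects the three shifted
  exponents into \<open>T^(n + 1)\<close>.\<close>

lemma resolvent_term_Suc:
  assumes d: "causal_bdd d" and F: "causal_bdd F" and \<alpha>: "0 < \<alpha>"
    and eq: "\<And>r. frac_int 1 d r =
      l1 * frac_int (a1 + 1) d r + l2 * frac_int (a2 + 1) d r + l3 * frac_int (a3 + 1) d r + frac_int \<alpha> F r"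
  shows "resolvent_term n 1 d r = resolvent_term (Suc n) 1 d r + resolvent_term n \<alpha> F r"
proof -
  have step: "frac_int (e + 1) d r = l1 * frac_int (e + a1 + 1) d r + l2 * frac_int (e + a2 + 1) d r +
      l3 * frac_int (e + a3 + 1) d r + frac_int (e + \<alpha>) F r" if e: "0 \<le> e" for e
  \<comment> \<open>The semigroup law needs positive orders, and \<open>frac_int 0\<close> is zero
    rather than the identity. For \<open>e = 0\<close> the claim is \<open>eq\<close>
    itself.\<close>
  proof (cases "e = 0")
    case True
    then show ?thesis using eq[of r] by simp
  next
    case False
    with e have e: "0 < e" by simp
    have c: "causal_bdd (frac_int (b + 1) d)" if "0 < b" for b
      using that d by (intro causal_bdd_frac_int) auto
    have "frac_int (e + 1) d r = frac_int e (frac_int 1 d) r"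
      using e d by (simp add: frac_int_frac_int)
    also have "frac_int 1 d = (\<lambda>r. l1 * frac_int (a1 + 1) d r + l2 * frac_int (a2 + 1) d r +
        l3 * frac_int (a3 + 1) d r + frac_int \<alpha> F r)"
      using eq by blast
    also have "frac_int e \<dots> r = l1 * frac_int e (frac_int (a1 + 1) d) r + l2 * frac_int e (frac_int (a2 + 1) d) r +
        l3 * frac_int e (frac_int (a3 + 1) d) r + frac_int e (frac_int \<alpha> F) r"
      using e \<alpha> a1 a2 a3 F
      by (simp add: frac_int_add frac_int_cmult causal_bdd_add causal_bdd_cmult causal_bdd_frac_int c)
    also have "\<dots> = l1 * frac_int (e + a1 + 1) d r + l2 * frac_int (e + a2 + 1) d r +
      l3 * frac_int (e + a3 + 1) d r + frac_int (e + \<alpha>) F r"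
      using e \<alpha> a1 a2 a3 F d by (simp add: frac_int_frac_int add.assoc)
    finally show ?thesis .
  qed
  have shift: "expo (Suc l) p k = expo l p k + a1" "expo l (Suc p) k = expo l p k + a2"
    "expo l p (Suc k) = expo l p k + a3" for l p k
    by (simp_all add: expo_def algebra_simps)
  show ?thesis
    unfolding resolvent_term_def sum_simplex3_Suc sum.distrib[symmetric]
  proof (rule sum.cong[OF refl], clarify)
    fix l p k
    show "trinom l p k * (l1 ^ l * l2 ^ p * l3 ^ k * frac_int (expo l p k + 1) d r) =
      trinom l p k * (l1 ^ Suc l * l2 ^ p * l3 ^ k * frac_int (expo (Suc l) p k + 1) d r +
        l1 ^ l * l2 ^ Suc p * l3 ^ k * frac_int (expo l (Suc p) k + 1) d r +
        l1 ^ l * l2 ^ p * l3 ^ Suc k * frac_int (expo l p (Suc k) + 1) d r) +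
      trinom l p k * (l1 ^ l * l2 ^ p * l3 ^ k * frac_int (expo l p k + \<alpha>) F r)"
      unfolding shift step[OF expo_nonneg] by (simp add: algebra_simps)
  qed
qed

lemma resolvent_telescope:
  assumes "causal_bdd d" "causal_bdd F" "0 < \<alpha>"
    and "\<And>r. frac_int 1 d r =
      l1 * frac_int (a1 + 1) d r + l2 * frac_int (a2 + 1) d r + l3 * frac_int (a3 + 1) d r + frac_int \<alpha> F r"
  shows "frac_int 1 d r = resolvent_term N 1 d r + (\<Sum>n<N. resolvent_term n \<alpha> F r)"
proof (induction N)
  case 0
  show ?case by (simp add: resolvent_term_def simplex3_0 trinom_def expo_def)
next
  case (Suc N)
  then show ?case using resolvent_term_Suc[OF assms, of N r] by simp
qed

section \<open>Convergence of the Neumann series to the Mittag-Leffler kernel\<close>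

lemma sum_frac_ker_tendsto:
  assumes "0 < \<delta>"
  shows "(\<lambda>N. \<Sum>n<N. \<Sum>(l,p,k)\<in>simplex3 n. trinom l p k * (l1 ^ l * l2 ^ p * l3 ^ k * frac_ker (expo l p k + \<delta>) t))
    \<longlonglongrightarrow> ml_ker \<delta> t"
proof (cases "0 < t")
  case False
  then show ?thesis by (simp add: ml_ker_def frac_ker_def case_prod_unfold)
next
  case True
  have "(\<lambda>N. t powr (\<delta> - 1) * (\<Sum>n<N. \<Sum>x\<in>simplex3 n. ml_term a1 a2 a3 \<delta> (l1 * t powr a1) (l2 * t powr a2) (l3 * t powr a3) x))
    \<longlonglongrightarrow> ml_ker \<delta> t"
    using True ML3_partial_sums[OF a1 a2 a3 assms] by (auto simp: ml_ker_def intro!: tendsto_mult_left)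
  also have "(\<lambda>N. t powr (\<delta> - 1) * (\<Sum>n<N. \<Sum>x\<in>simplex3 n. ml_term a1 a2 a3 \<delta> (l1 * t powr a1) (l2 * t powr a2) (l3 * t powr a3) x)) =
    (\<lambda>N. \<Sum>n<N. \<Sum>(l,p,k)\<in>simplex3 n. trinom l p k * (l1 ^ l * l2 ^ p * l3 ^ k * frac_ker (expo l p k + \<delta>) t))"
    unfolding frac_ker_expo[OF True] sum_distrib_left by (simp add: case_prod_unfold)
  finally show ?thesis .
qed

text \<open>The partial sums increase, and by \<open>abs_ml_term\<close> their limit is the series
  at the absolute values of the arguments.\<close>

lemma sum_abs_ml_term_le:
  assumes "0 < \<delta>"
  shows "(\<Sum>n<N. \<Sum>x\<in>simplex3 n. \<bar>ml_term a1 a2 a3 \<delta> u v w x\<bar>) \<le> ML3 a1 a2 a3 \<delta> (\<bar>u\<bar>) (\<bar>v\<bar>) (\<bar>w\<bar>)"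
proof -
  let ?S = "\<lambda>N. \<Sum>n<N. \<Sum>x\<in>simplex3 n. \<bar>ml_term a1 a2 a3 \<delta> u v w x\<bar>"
  have "incseq ?S"
    by (rule incseq_SucI) (simp add: sum_nonneg)
  moreover have "?S \<longlonglongrightarrow> ML3 a1 a2 a3 \<delta> (\<bar>u\<bar>) (\<bar>v\<bar>) (\<bar>w\<bar>)"
    unfolding abs_ml_term[OF a1 a2 a3 assms] by (rule ML3_partial_sums[OF a1 a2 a3 assms])
  ultimately show ?thesis by (rule incseq_le)
qed

lemma abs_ml_term_mono:
  assumes "0 < \<delta>" "\<bar>u\<bar> \<le> \<bar>u'\<bar>" "\<bar>v\<bar> \<le> \<bar>v'\<bar>" "\<bar>w\<bar> \<le> \<bar>w'\<bar>"
  shows "\<bar>ml_term a1 a2 a3 \<delta> u v w x\<bar> \<le> \<bar>ml_term a1 a2 a3 \<delta> u' v' w' x\<bar>"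
proof -
  obtain l p k where x: "x = (l, p, k)" by (cases x)
  have "\<bar>u\<bar> ^ l * \<bar>v\<bar> ^ p * \<bar>w\<bar> ^ k \<le> \<bar>u'\<bar> ^ l * \<bar>v'\<bar> ^ p * \<bar>w'\<bar> ^ k"
    using assms(2-4) by (intro mult_mono power_mono) auto
  then show ?thesis
    by (simp add: x ml_term_def abs_mult power_abs mult_left_mono mult_right_mono)
qed

text \<open>A majorant for dominated convergence. It is uniform in \<open>N\<close>: the arguments
  of the series are frozen at \<open>r\<close>, and the possibly singular power of \<open>t\<close>
  is kept as the integrable factor \<open>frac_ker \<delta> t\<close>.\<close>

lemma sum_frac_ker_le:
  assumes \<delta>: "0 < \<delta>" and "t \<le> r"
  shows "\<bar>\<Sum>n<N. \<Sum>(l,p,k)\<in>simplex3 n. trinom l p k * (l1 ^ l * l2 ^ p * l3 ^ k * frac_ker (expo l p k + \<delta>) t)\<bar> \<le>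
    Gamma \<delta> * ML3 a1 a2 a3 \<delta> (\<bar>l1 * r powr a1\<bar>) (\<bar>l2 * r powr a2\<bar>) (\<bar>l3 * r powr a3\<bar>) * frac_ker \<delta> t"
proof (cases "0 < t")
  case False
  then show ?thesis by (simp add: frac_ker_def case_prod_unfold)
next
  case t: True
  have G: "Gamma \<delta> \<noteq> 0" using \<delta> by (simp add: Gamma_real_pos less_imp_neq[symmetric])
  let ?m = "ml_term a1 a2 a3 \<delta> (l1 * t powr a1) (l2 * t powr a2) (l3 * t powr a3)"
  let ?m' = "ml_term a1 a2 a3 \<delta> (l1 * r powr a1) (l2 * r powr a2) (l3 * r powr a3)"
  have arg: "\<bar>c * t powr a\<bar> \<le> \<bar>c * r powr a\<bar>" if "0 < a" for a c :: real
    using t assms(2) that by (simp add: abs_mult mult_left_mono powr_mono2)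
  have "\<bar>\<Sum>n<N. \<Sum>x\<in>simplex3 n. ?m x\<bar> \<le> (\<Sum>n<N. \<bar>\<Sum>x\<in>simplex3 n. ?m x\<bar>)"
    by (rule sum_abs)
  also have "\<dots> \<le> (\<Sum>n<N. \<Sum>x\<in>simplex3 n. \<bar>?m x\<bar>)"
    by (rule sum_mono, rule sum_abs)
  also have "\<dots> \<le> (\<Sum>n<N. \<Sum>x\<in>simplex3 n. \<bar>?m' x\<bar>)"
    by (rule sum_mono, rule sum_mono, rule abs_ml_term_mono[OF \<delta> arg[OF a1] arg[OF a2] arg[OF a3]])
  also have "\<dots> \<le> ML3 a1 a2 a3 \<delta> (\<bar>l1 * r powr a1\<bar>) (\<bar>l2 * r powr a2\<bar>) (\<bar>l3 * r powr a3\<bar>)"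
    by (rule sum_abs_ml_term_le[OF \<delta>])
  finally have le: "\<bar>\<Sum>n<N. \<Sum>x\<in>simplex3 n. ?m x\<bar> \<le>
      ML3 a1 a2 a3 \<delta> (\<bar>l1 * r powr a1\<bar>) (\<bar>l2 * r powr a2\<bar>) (\<bar>l3 * r powr a3\<bar>)" .
  have eq: "(\<Sum>n<N. \<Sum>(l,p,k)\<in>simplex3 n. trinom l p k * (l1 ^ l * l2 ^ p * l3 ^ k * frac_ker (expo l p k + \<delta>) t)) =
     t powr (\<delta> - 1) * (\<Sum>n<N. \<Sum>x\<in>simplex3 n. ?m x)"
    unfolding frac_ker_expo[OF t] by (simp add: case_prod_unfold sum_distrib_left)
  have "\<bar>t powr (\<delta> - 1) * (\<Sum>n<N. \<Sum>x\<in>simplex3 n. ?m x)\<bar> \<le>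
      t powr (\<delta> - 1) * ML3 a1 a2 a3 \<delta> (\<bar>l1 * r powr a1\<bar>) (\<bar>l2 * r powr a2\<bar>) (\<bar>l3 * r powr a3\<bar>)"
    using mult_left_mono[OF le, of "t powr (\<delta> - 1)"] by (simp add: abs_mult)
  moreover have "t powr (\<delta> - 1) = Gamma \<delta> * frac_ker \<delta> t"
    using t G by (simp add: frac_ker_def rGamma_inverse_Gamma)
  ultimately show ?thesis
    unfolding eq by (simp only: mult_ac)
qed

text \<open>The partial sums of \<open>resolvent_term\<close> are convolutions of \<open>f\<close>
  with the partial kernels \<open>K N\<close>, so dominated convergence gives both claims.\<close>

lemma resolvent_sum_tendsto:
  assumes \<delta>: "0 < \<delta>" and f: "causal_bdd f"
  shows "integrable lborel (\<lambda>s. ml_ker \<delta> (r - s) * f s)"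
    and "(\<lambda>N. \<Sum>n<N. resolvent_term n \<delta> f r) \<longlonglongrightarrow> (LINT s|lborel. ml_ker \<delta> (r - s) * f s)"
proof -
  define K where "K N t = (\<Sum>n<N. \<Sum>(l,p,k)\<in>simplex3 n.
      trinom l p k * (l1 ^ l * l2 ^ p * l3 ^ k * frac_ker (expo l p k + \<delta>) t))" for N t
  note [measurable] = causal_bddD(1)[OF f]
  have [measurable]: "K N \<in> borel_measurable borel" for N
    unfolding K_def case_prod_unfold by measurable
  have K_lim: "(\<lambda>N. K N t) \<longlonglongrightarrow> ml_ker \<delta> t" for t
    unfolding K_def by (rule sum_frac_ker_tendsto[OF \<delta>])
  have [measurable]: "ml_ker \<delta> \<in> borel_measurable borel"
    by (rule borel_measurable_LIMSEQ_real[OF K_lim]) measurable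
  define C where "C = Gamma \<delta> * ML3 a1 a2 a3 \<delta> (\<bar>l1 * r powr a1\<bar>) (\<bar>l2 * r powr a2\<bar>) (\<bar>l3 * r powr a3\<bar>)"
  have bound: "\<bar>K N (r - s) * f s\<bar> \<le> C * \<bar>frac_ker \<delta> (r - s) * f s\<bar>" for N s
  \<comment> \<open>The kernel bound covers only arguments up to \<open>r\<close>, that is
    \<open>s \<ge> 0\<close>; for \<open>s \<le> 0\<close> the factor \<open>f s\<close> is
    zero.\<close>
  proof (cases "0 < s")
    case True
    then have "\<bar>K N (r - s)\<bar> \<le> C * frac_ker \<delta> (r - s)"
      unfolding K_def C_def by (intro sum_frac_ker_le[OF \<delta>]) simp
    then show ?thesis
      by (simp add: abs_mult frac_ker_nonneg[OF \<delta>] mult.assoc[symmetric] mult_right_mono)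
  qed (simp add: causal_bddD(2)[OF f])
  have sum_eq: "(LINT s|lborel. K N (r - s) * f s) = (\<Sum>n<N. resolvent_term n \<delta> f r)" for N
  proof -
    have "has_bochner_integral lborel (\<lambda>s. \<Sum>n<N. \<Sum>x\<in>simplex3 n. (case x of (l,p,k) \<Rightarrow>
        trinom l p k * (l1 ^ l * l2 ^ p * l3 ^ k * (frac_ker (expo l p k + \<delta>) (r - s) * f s))))
        (\<Sum>n<N. \<Sum>x\<in>simplex3 n. (case x of (l,p,k) \<Rightarrow>
        trinom l p k * (l1 ^ l * l2 ^ p * l3 ^ k * frac_int (expo l p k + \<delta>) f r)))"
    proof (intro has_bochner_integral_sum)
      fix x :: "nat \<times> nat \<times> nat"
      obtain l p k where x: "x = (l, p, k)" by (cases x)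
      have "0 < expo l p k + \<delta>" using expo_nonneg[of l p k] \<delta> by simp
      then have "has_bochner_integral lborel (\<lambda>s. frac_ker (expo l p k + \<delta>) (r - s) * f s) (frac_int (expo l p k + \<delta>) f r)"
        using frac_int_integrable[OF _ f] by (simp add: has_bochner_integral_iff frac_int_def)
      then show "has_bochner_integral lborel (\<lambda>s. case x of (l,p,k) \<Rightarrow>
        trinom l p k * (l1 ^ l * l2 ^ p * l3 ^ k * (frac_ker (expo l p k + \<delta>) (r - s) * f s)))
        (case x of (l,p,k) \<Rightarrow> trinom l p k * (l1 ^ l * l2 ^ p * l3 ^ k * frac_int (expo l p k + \<delta>) f r))"
        unfolding x prod.case by (intro has_bochner_integral_mult_right)
    qed
    then have "(LINT s|lborel. (\<Sum>n<N. \<Sum>x\<in>simplex3 n. (case x of (l,p,k) \<Rightarrow>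
        trinom l p k * (l1 ^ l * l2 ^ p * l3 ^ k * (frac_ker (expo l p k + \<delta>) (r - s) * f s))))) =
        (\<Sum>n<N. resolvent_term n \<delta> f r)"
      by (simp add: has_bochner_integral_iff resolvent_term_def)
    then show ?thesis
      by (simp add: K_def sum_distrib_right case_prod_unfold mult.assoc)
  qed
  have dom: "integrable lborel (\<lambda>s. C * \<bar>frac_ker \<delta> (r - s) * f s\<bar>)"
    using frac_int_integrable[OF \<delta> f, of r] by simp
  have lim: "(\<lambda>N. K N (r - s) * f s) \<longlonglongrightarrow> ml_ker \<delta> (r - s) * f s" for s
    by (intro tendsto_mult K_lim tendsto_const)
  show "integrable lborel (\<lambda>s. ml_ker \<delta> (r - s) * f s)"
    by (rule integrable_dominated_convergence[OF _ _ dom, where s = "\<lambda>N s. K N (r - s) * f s"])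
       (use bound lim in auto)
  have "(\<lambda>N. LINT s|lborel. K N (r - s) * f s) \<longlonglongrightarrow> (LINT s|lborel. ml_ker \<delta> (r - s) * f s)"
    by (rule integral_dominated_convergence[OF _ _ dom]) (use bound lim in auto)
  then show "(\<lambda>N. \<Sum>n<N. resolvent_term n \<delta> f r) \<longlonglongrightarrow> (LINT s|lborel. ml_ker \<delta> (r - s) * f s)"
    by (simp add: sum_eq)
qed

text \<open>Terms of a convergent series tend to zero; with \<open>\<delta> = 1\<close> and
  \<open>f = d\<close> this removes the remainder of the iteration.\<close>

lemma resolvent_term_tendsto_0:
  assumes "0 < \<delta>" "causal_bdd f"
  shows "(\<lambda>N. resolvent_term N \<delta> f r) \<longlonglongrightarrow> 0"
  using resolvent_sum_tendsto(2)[OF assms, of r]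
  by (intro summable_LIMSEQ_zero) (auto simp: summable_def sums_def)

text \<open>Integrating the unit step raises the order of the kernel by one, so a constant source
  gives a kernel value instead of an integral. This is the origin of the parameter
  \<open>\<alpha> + 1\<close> in the solution formula.\<close>

lemma resolvent_sum_frac_ker_1_tendsto:
  assumes "0 < \<delta>"
  shows "(\<lambda>N. \<Sum>n<N. resolvent_term n \<delta> (frac_ker 1) r) \<longlonglongrightarrow> ml_ker (\<delta> + 1) r"
proof -
  have "frac_int (expo l p k + \<delta>) (frac_ker 1) r = frac_ker (expo l p k + (\<delta> + 1)) r" for l p k
    using expo_nonneg[of l p k] assms by (simp add: frac_int_frac_ker_1 add.assoc)
  then show ?thesis
    using sum_frac_ker_tendsto[of "\<delta> + 1" r] assms by (simp only: resolvent_term_def)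
qed

text \<open>The limit of the telescoped identity, whose left side does not depend on
  \<open>N\<close>. The source is split by linearity so that its constant part is evaluated in
  closed form.\<close>

lemma resolvent_representation:
  assumes d: "causal_bdd d" and G: "causal_bdd G" and \<alpha>: "0 < \<alpha>"
    and eq: "\<And>r. frac_int 1 d r =
      l1 * frac_int (a1 + 1) d r + l2 * frac_int (a2 + 1) d r + l3 * frac_int (a3 + 1) d r +
      frac_int \<alpha> (\<lambda>s. c * frac_ker 1 s + G s) r"
  shows "frac_int 1 d r = c * ml_ker (\<alpha> + 1) r + (LINT s|lborel. ml_ker \<alpha> (r - s) * G s)"
proof -
  let ?F = "\<lambda>s. c * frac_ker 1 s + G s"
  have F: "causal_bdd ?F"
    by (intro causal_bdd_add causal_bdd_cmult causal_bdd_frac_ker_1 G)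
  have split: "resolvent_term n \<alpha> ?F r = c * resolvent_term n \<alpha> (frac_ker 1) r + resolvent_term n \<alpha> G r" for n
  proof -
    have "0 < expo l p k + \<alpha>" for l p k using expo_nonneg[of l p k] \<alpha> by simp
    then have "frac_int (expo l p k + \<alpha>) ?F r =
        c * frac_int (expo l p k + \<alpha>) (frac_ker 1) r + frac_int (expo l p k + \<alpha>) G r" for l p k
      by (simp only: frac_int_add causal_bdd_cmult causal_bdd_frac_ker_1 G frac_int_cmult)
    then show ?thesis
      unfolding resolvent_term_def sum_distrib_left sum.distrib[symmetric]
      by (intro sum.cong) (auto simp: algebra_simps)
  qed
  have "(\<lambda>N. resolvent_term N 1 d r + (c * (\<Sum>n<N. resolvent_term n \<alpha> (frac_ker 1) r) + (\<Sum>n<N. resolvent_term n \<alpha> G r)))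
      \<longlonglongrightarrow> 0 + (c * ml_ker (\<alpha> + 1) r + (LINT s|lborel. ml_ker \<alpha> (r - s) * G s))"
    by (intro tendsto_add tendsto_mult tendsto_const resolvent_term_tendsto_0 d zero_less_one
        resolvent_sum_frac_ker_1_tendsto \<alpha> resolvent_sum_tendsto(2) G)
  also have "(\<lambda>N. resolvent_term N 1 d r + (c * (\<Sum>n<N. resolvent_term n \<alpha> (frac_ker 1) r) + (\<Sum>n<N. resolvent_term n \<alpha> G r))) =
      (\<lambda>_. frac_int 1 d r)"
    using resolvent_telescope[OF d F \<alpha> eq, of r]
    by (simp add: split sum.distrib sum_distrib_left)
  finally show ?thesis
    using LIMSEQ_unique[OF tendsto_const] by simp
qed

end

section \<open>Reduction of the Cauchy problem to the integral equation\<close>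

theorem theorem4p3:
  fixes \<alpha> \<beta> \<gamma> l1 l2 l3 y0 :: real and g y :: "real \<Rightarrow> real"
  assumes "\<alpha> \<le> 1" and "\<beta> < \<alpha>" and "\<gamma> < \<beta>" and "0 < \<gamma>"
    and "continuous_on {0..} g"
    and "C1_nonneg y"
    and "\<forall>r>0. caputo \<alpha> y r - l3 * caputo \<beta> y r - l2 * caputo \<gamma> y r - l1 * y r = g r"
    and "y 0 = y0"
  shows "\<forall>r\<ge>0. y r =
    (1 + l1 * r powr \<alpha> * ML3 \<alpha> (\<alpha> - \<gamma>) (\<alpha> - \<beta>) (\<alpha> + 1)
           (l1 * r powr \<alpha>) (l2 * r powr (\<alpha> - \<gamma>)) (l3 * r powr (\<alpha> - \<beta>))) * y0
    + integral {0..r} (\<lambda>s. (r - s) powr (\<alpha> - 1) *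
        ML3 \<alpha> (\<alpha> - \<gamma>) (\<alpha> - \<beta>) \<alpha>
          (l1 * (r - s) powr \<alpha>) (l2 * (r - s) powr (\<alpha> - \<gamma>)) (l3 * (r - s) powr (\<alpha> - \<beta>)) * g s)"
proof (intro allI impI)
  fix r :: real assume r0: "0 \<le> r"
  note [simp] = \<open>y 0 = y0\<close>
  have pos: "0 < \<alpha>" "0 < \<beta>" "\<beta> < 1" "\<gamma> < 1" "0 < \<alpha> - \<gamma>" "0 < \<alpha> - \<beta>"
    using assms(1-4) by auto
  interpret ml_resolvent \<alpha> "\<alpha> - \<gamma>" "\<alpha> - \<beta>" l1 l2 l3
    by unfold_locales (use pos in auto)
  obtain y' where y': "\<And>r. 0 \<le> r \<Longrightarrow> (y has_real_derivative y' r) (at r within {0..})"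
    and cont: "continuous_on {0..} y'"
    using assms(6) unfolding C1_nonneg_def by blast
  \<comment> \<open>Cutting off at \<open>0\<close> makes the data causal; only their values on the
    positive axis enter the integrals.\<close>
  define d where "d = (\<lambda>x. if 0 < x then y' x else 0)"
  define G where "G = (\<lambda>x. if 0 < x then g x else 0)"
  have d: "causal_bdd d" and G: "causal_bdd G"
    unfolding d_def G_def using cont assms(5) by (simp_all add: causal_bdd_continuous)
  \<comment> \<open>At an interior point of \<open>{0..}\<close> the one-sided filter is the full
    neighbourhood filter.\<close>
  have deriv_y: "deriv y s = y' s" if "0 < s" for s
  proof -
    have "at s within {0..} = at s"
      using that by (intro at_within_interior) (simp add: interior_real_atLeast)
    then show ?thesis using y'[of s] that by (intro DERIV_imp_deriv) simp
  qed
  have caputo_eq: "caputo \<rho> y s = frac_int (1 - \<rho>) d s" if "\<rho> < 1" for \<rho> s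
  proof -
    have "Gamma (1 - \<rho>) \<noteq> 0" using that by (simp add: Gamma_real_pos less_imp_neq[symmetric])
    moreover have "((\<lambda>t. (s - t) powr (- \<rho>) * deriv y t) has_integral Gamma (1 - \<rho>) * frac_int (1 - \<rho>) d s) {0..s}"
      by (rule has_integral_frac_int[OF _ d]) (use that deriv_y in \<open>auto simp: d_def\<close>)
    ultimately show ?thesis using that by (simp add: caputo_def integral_unique)
  qed
  have y_eq: "y s = y0 + frac_int 1 d s" if "0 < s" for s
  proof -
    have "(y' has_integral y s - y 0) {0..s}"
    proof (rule fundamental_theorem_of_calculus)
      fix x assume "x \<in> {0..s}"
      then have "(y has_real_derivative y' x) (at x within {0..s})"
        using y'[of x] by (auto intro: has_field_derivative_subset)
      then show "(y has_vector_derivative y' x) (at x within {0..s})"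
        by (simp add: has_real_derivative_iff_has_vector_derivative)
    qed (use that in simp)
    moreover have "(y' has_integral Gamma 1 * frac_int 1 d s) {0..s}"
      by (rule has_integral_frac_int[OF _ d]) (auto simp: d_def)
    ultimately have "y s - y 0 = Gamma 1 * frac_int 1 d s" by (rule has_integral_unique)
    then show ?thesis by simp
  qed
  \<comment> \<open>The equation solved for the derivative of order \<open>\<alpha>\<close>, with
    \<open>y = y0 + I^1 d\<close> inserted and extended by zero. The constant \<open>l1 * y0\<close>
    becomes a multiple of the unit step.\<close>
  define D where "D = (\<lambda>s. l1 * frac_int 1 d s + l2 * frac_int (1 - \<gamma>) d s + l3 * frac_int (1 - \<beta>) d s +
      ((l1 * y0) * frac_ker 1 s + G s))"
  have D_caputo: "D s = caputo \<alpha> y s" if "0 < s" for s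
  proof -
    have "caputo \<alpha> y s = l1 * y s + l2 * caputo \<gamma> y s + l3 * caputo \<beta> y s + g s"
      using assms(7) that by (auto simp: algebra_simps)
    then show ?thesis
      using that pos by (simp add: D_def caputo_eq y_eq frac_ker_1 G_def algebra_simps)
  qed
  have D_nonpos: "D s = 0" if "s \<le> 0" for s
    using that d by (simp add: D_def frac_int_nonpos frac_ker_1 G_def)
  have cG: "causal_bdd (\<lambda>s. (l1 * y0) * frac_ker 1 s + G s)"
    by (intro causal_bdd_add causal_bdd_cmult causal_bdd_frac_ker_1 G)
  \<comment> \<open>For \<open>\<alpha> < 1\<close> this is the semigroup law applied to
    \<open>D = I^(1 - \<alpha>) d\<close>. For \<open>\<alpha> = 1\<close> the Caputo derivative is
    the ordinary one and \<open>D = d\<close>.\<close>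
  have int_D: "frac_int \<alpha> D s = frac_int 1 d s" for s
  proof (cases "\<alpha> = 1")
    case True
    have "D = d"
    proof
      fix s show "D s = d s"
        using D_caputo[of s] D_nonpos[of s] True by (cases "0 < s") (auto simp: caputo_def d_def deriv_y)
    qed
    then show ?thesis using True by simp
  next
    case False
    then have \<alpha>: "0 < 1 - \<alpha>" using assms(1) by simp
    have "D = frac_int (1 - \<alpha>) d"
    proof
      fix s show "D s = frac_int (1 - \<alpha>) d s"
        using D_caputo[of s] D_nonpos[of s] \<alpha> d by (cases "0 < s") (auto simp: caputo_eq frac_int_nonpos)
    qed
    then show ?thesis using pos \<alpha> d by (simp add: frac_int_frac_int)
  qed
  \<comment> \<open>Applying \<open>I^\<alpha>\<close> to the definition of \<open>D\<close> and
    adding orders gives the hypothesis of \<open>resolvent_representation\<close> with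
    \<open>c = l1 * y0\<close>.\<close>
  have eq: "frac_int 1 d s = l1 * frac_int (\<alpha> + 1) d s + l2 * frac_int (\<alpha> - \<gamma> + 1) d s +
      l3 * frac_int (\<alpha> - \<beta> + 1) d s + frac_int \<alpha> (\<lambda>s. (l1 * y0) * frac_ker 1 s + G s) s" for s
  proof -
    have "frac_int 1 d s = frac_int \<alpha> D s" by (simp add: int_D)
    also have "\<dots> = l1 * frac_int \<alpha> (frac_int 1 d) s + l2 * frac_int \<alpha> (frac_int (1 - \<gamma>) d) s +
      l3 * frac_int \<alpha> (frac_int (1 - \<beta>) d) s + frac_int \<alpha> (\<lambda>s. (l1 * y0) * frac_ker 1 s + G s) s"
      unfolding D_def using pos d cG
      by (simp add: frac_int_add frac_int_cmult causal_bdd_add causal_bdd_cmult causal_bdd_frac_int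
          del: mult.assoc)
    also have "frac_int \<alpha> (frac_int 1 d) s = frac_int (\<alpha> + 1) d s"
      using pos d by (simp add: frac_int_frac_int)
    also have "frac_int \<alpha> (frac_int (1 - \<gamma>) d) s = frac_int (\<alpha> - \<gamma> + 1) d s"
      using pos d by (simp add: frac_int_frac_int algebra_simps)
    also have "frac_int \<alpha> (frac_int (1 - \<beta>) d) s = frac_int (\<alpha> - \<beta> + 1) d s"
      using pos d by (simp add: frac_int_frac_int algebra_simps)
    finally show ?thesis .
  qed
  show "y r =
    (1 + l1 * r powr \<alpha> * ML3 \<alpha> (\<alpha> - \<gamma>) (\<alpha> - \<beta>) (\<alpha> + 1)
           (l1 * r powr \<alpha>) (l2 * r powr (\<alpha> - \<gamma>)) (l3 * r powr (\<alpha> - \<beta>))) * y0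
    + integral {0..r} (\<lambda>s. (r - s) powr (\<alpha> - 1) *
        ML3 \<alpha> (\<alpha> - \<gamma>) (\<alpha> - \<beta>) \<alpha>
          (l1 * (r - s) powr \<alpha>) (l2 * (r - s) powr (\<alpha> - \<gamma>)) (l3 * (r - s) powr (\<alpha> - \<beta>)) * g s)"
  \<comment> \<open>At \<open>r = 0\<close> the factor \<open>0 powr \<alpha>\<close> and the
    integral over \<open>{0..0}\<close> vanish, which leaves \<open>y0\<close>.\<close>
  proof (cases "r = 0")
    case True
    then show ?thesis by simp
  next
    case False
    with r0 have r: "0 < r" by simp
    have "((\<lambda>s. (r - s) powr (\<alpha> - 1) *
        ML3 \<alpha> (\<alpha> - \<gamma>) (\<alpha> - \<beta>) \<alpha>
          (l1 * (r - s) powr \<alpha>) (l2 * (r - s) powr (\<alpha> - \<gamma>)) (l3 * (r - s) powr (\<alpha> - \<beta>)) * g s)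
        has_integral (LINT s|lborel. ml_ker \<alpha> (r - s) * G s)) {0..r}"
      by (rule has_integral_of_lborel[OF resolvent_sum_tendsto(1)[OF pos(1) G]])
         (auto simp: ml_ker_def G_def)
    \<comment> \<open>\<open>ml_ker (\<alpha> + 1) r\<close> supplies the factor
      \<open>r powr \<alpha>\<close>; its multiple by \<open>l1 * y0\<close> joins the
      \<open>y0\<close> from \<open>y_eq\<close>.\<close>
    then show ?thesis
      using y_eq[OF r] resolvent_representation[OF d G pos(1) eq, of r] r
      by (simp add: integral_unique ml_ker_def algebra_simps)
  qed
qed

end
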